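(* Let $P$ be a polymatroid on $[n]$ with rank function $f$. Then (1) $x^{n-2}[\mathscr{T}_P(x,y)]=\binom{\sum_{i\in[n]}f(\{i\})-f([n])+1-n}{2}-\sum_{\{i,j\}\subset[n]}\binom{f(\{i\})+f(\{j\})-f(\{i,j\})}{2}$; (2) $y^{n-2}[\mathscr{T}_P(x,y)]=\binom{\sum_{i\in[n]}f([n]\setminus\{i\})-(n-1)f([n])+1-n}{2}-\sum_{\{i,j\}\subset[n]}\binom{f([n]\setminus\{i\})+f([n]\setminus\{j\})-f([n]\setminus\{i,j\})-f([n])}{2}$, where the sums run over two-element subsets $\{i,j\}$ of $[n]$.
   Context: A polymatroid on $[n]$ is $P=\{\mathbf a\in\mathbb{Z}^n\mid \sum_{i\in I}a_i\le f(I)\ \forall I,\ \sum_{i\in[n]}a_i=f([n])\}$ with $f(\emptyset)=0$, $f$ submodular (rank function). For $\mathbf a\in P$, $i$ is internally active if $\mathbf a-\mathbf e_i+\mathbf e_j\notin P$ for all $j<i$, externally active if $\mathbf a+\mathbf e_i-\mathbf e_j\notin P$ for all $j<i$; $\mathrm{Int}(\mathbf a),\mathrm{Ext}(\mathbf a)$ are these sets. $\mathscr{T}_P(x,y)=\sum_{\mathbf a\in P}x^{|\mathrm{Int}\setminus\mathrm{Ext}|}y^{|\mathrm{Ext}\setminus\mathrm{Int}|}(x+y-1)^{|\mathrm{Int}\cap\mathrm{Ext}|}$. $x^{i}[g]$ denotes the coefficient of $x^iy^0$ in $g$ and $y^j[g]$ the coefficient of $x^0y^j$. Binomial coefficients $\binom{m}{2}=m(m-1)/2$.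 *)

theory Defs
  imports "HOL-Computational_Algebra.Polynomial" "HOL-Library.Function_Algebras"
begin

text \<open>
  The ground set \<open>[n]\<close> is \<open>{1..n}\<close> with the usual order. A vector of \<open>\<int>\<^sup>n\<close> is a function
  \<open>nat \<Rightarrow> int\<close> that vanishes outside \<open>{1..n}\<close>; addition and subtraction of vectors are pointwise
  (\<open>Function_Algebras\<close>). Set functions are only constrained, and only used, on subsets
  of \<open>{1..n}\<close>.
\<close>

definition int_vectors :: "nat \<Rightarrow> (nat \<Rightarrow> int) set" where
  "int_vectors n = {a. \<forall>i. i \<notin> {1..n} \<longrightarrow> a i = 0}"

definition unit_vec :: "nat \<Rightarrow> nat \<Rightarrow> int" where
  "unit_vec i = (\<lambda>k. if k = i then 1 else 0)"

definition submodular :: "nat \<Rightarrow> (nat set \<Rightarrow> int) \<Rightarrow> bool" where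
  "submodular n f \<longleftrightarrow>
     (\<forall>I J. I \<subseteq> {1..n} \<longrightarrow> J \<subseteq> {1..n} \<longrightarrow> f (I \<union> J) + f (I \<inter> J) \<le> f I + f J)"

text \<open>Neither monotonicity nor nonnegativity of \<open>f\<close> is required.\<close>

definition rank_function :: "nat \<Rightarrow> (nat set \<Rightarrow> int) \<Rightarrow> bool" where
  "rank_function n f \<longleftrightarrow> f {} = 0 \<and> submodular n f"

definition polymatroid :: "nat \<Rightarrow> (nat set \<Rightarrow> int) \<Rightarrow> (nat \<Rightarrow> int) set" where
  "polymatroid n f =
     {a \<in> int_vectors n.
        (\<forall>I. I \<subseteq> {1..n} \<longrightarrow> (\<Sum>i\<in>I. a i) \<le> f I) \<and> (\<Sum>i\<in>{1..n}. a i) = f {1..n}}"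

definition is_polymatroid_with_rank ::
    "nat \<Rightarrow> (nat \<Rightarrow> int) set \<Rightarrow> (nat set \<Rightarrow> int) \<Rightarrow> bool" where
  "is_polymatroid_with_rank n P f \<longleftrightarrow> rank_function n f \<and> P = polymatroid n f"

definition int_active :: "nat \<Rightarrow> (nat \<Rightarrow> int) set \<Rightarrow> (nat \<Rightarrow> int) \<Rightarrow> nat set" where
  "int_active n P a =
     {i \<in> {1..n}. \<forall>j\<in>{1..n}. j < i \<longrightarrow> a - unit_vec i + unit_vec j \<notin> P}"

definition ext_active :: "nat \<Rightarrow> (nat \<Rightarrow> int) set \<Rightarrow> (nat \<Rightarrow> int) \<Rightarrow> nat set" where
  "ext_active n P a =
     {i \<in> {1..n}. \<forall>j\<in>{1..n}. j < i \<longrightarrow> a + unit_vec i - unit_vec j \<notin> P}"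

text \<open>
  Elements of \<open>\<int>[x,y]\<close> are represented as polynomials in \<open>y\<close> whose coefficients are polynomials
  in \<open>x\<close>.
\<close>

definition var_x :: "int poly poly" where
  "var_x = [:[:0, 1:]:]"

definition var_y :: "int poly poly" where
  "var_y = [:0, 1:]"

text \<open>The sum below is over a finite set, see \<open>finite_polymatroid\<close>.\<close>

definition polymatroid_Tutte :: "nat \<Rightarrow> (nat \<Rightarrow> int) set \<Rightarrow> int poly poly" where
  "polymatroid_Tutte n P =
     (\<Sum>a\<in>P. var_x ^ card (int_active n P a - ext_active n P a)
            * var_y ^ card (ext_active n P a - int_active n P a)
            * (var_x + var_y - 1) ^ card (int_active n P a \<inter> ext_active n P a))"

text \<open>
  \<open>x_coeff k g\<close> and \<open>y_coeff k g\<close> are the coefficients of \<open>x\<^sup>k y\<^sup>0\<close> and \<open>x\<^sup>0 y\<^sup>k\<close> in \<open>g\<close>. The exponent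
  is an integer so that \<open>k = n - 2\<close> is not truncated for \<open>n < 2\<close>: a polynomial has
  coefficient \<open>0\<close> at a negative exponent.
\<close>

definition x_coeff :: "int \<Rightarrow> int poly poly \<Rightarrow> int" where
  "x_coeff k g = (if k < 0 then 0 else coeff (coeff g 0) (nat k))"

definition y_coeff :: "int \<Rightarrow> int poly poly \<Rightarrow> int" where
  "y_coeff k g = (if k < 0 then 0 else coeff (coeff g (nat k)) 0)"

lemma finite_polymatroid: "finite (polymatroid n f)"
proof -
  define B where "B = (\<Sum>i\<in>{1..n}. \<bar>f {i}\<bar>) + \<bar>f {1..n}\<bar>"
  have "polymatroid n f \<subseteq> {a. \<forall>i. (i \<in> {1..n} \<longrightarrow> a i \<in> {-B..B}) \<and> (i \<notin> {1..n} \<longrightarrow> a i = 0)}"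
  proof (intro subsetI CollectI allI conjI impI)
    fix a i assume a: "a \<in> polymatroid n f" and i: "i \<in> {1..n}"
    have le: "a k \<le> f {k}" if "k \<in> {1..n}" for k
    proof -
      have "(\<Sum>i\<in>{k}. a i) \<le> f {k}" using a that unfolding polymatroid_def by blast
      then show ?thesis by simp
    qed
    have tot: "(\<Sum>k\<in>{1..n}. a k) = f {1..n}" using a by (simp add: polymatroid_def)
    have s: "(\<Sum>k\<in>{1..n}. g k) = g i + (\<Sum>k\<in>{1..n}-{i}. g k)" for g :: "nat \<Rightarrow> int"
      using i by (simp add: sum.remove)
    have "(\<Sum>k\<in>{1..n}-{i}. a k) \<le> (\<Sum>k\<in>{1..n}-{i}. \<bar>f {k}\<bar>)"
      by (rule sum_mono) (use le in force)
    moreover have "0 \<le> (\<Sum>k\<in>{1..n}-{i}. \<bar>f {k}\<bar>)" by (simp add: sum_nonneg)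
    ultimately have "a i \<le> B \<and> - B \<le> a i"
      using le[OF i] tot s[of a] s[of "\<lambda>k. \<bar>f {k}\<bar>"] unfolding B_def by linarith
    then show "a i \<in> {-B..B}" by simp
  next
    fix a i assume "a \<in> polymatroid n f" and "i \<notin> {1..n}"
    then show "a i = 0" by (simp add: polymatroid_def int_vectors_def)
  qed
  moreover have "finite {a. \<forall>i. (i \<in> {1..n} \<longrightarrow> a i \<in> {-B..B}) \<and> (i \<notin> {1..n} \<longrightarrow> a i = (0::int))}"
    by (rule finite_set_of_finite_funs) auto
  ultimately show ?thesis by (rule finite_subset)
qed

text \<open>
  \<open>binom2 m\<close> is the binomial coefficient \<open>m(m - 1)/2\<close>, also for negative \<open>m\<close>. It is defined directly on
  the integers because \<open>gchoose\<close> would coerce its arguments to a field; \<open>of_int_binom2\<close> relates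
  the two.
\<close>

definition binom2 :: "int \<Rightarrow> int" where
  "binom2 m = m * (m - 1) div 2"

lemma two_times_binom2: "2 * binom2 m = m * (m - 1)"
  unfolding binom2_def by (rule dvd_mult_div_cancel) simp

lemma of_int_binom2: "(of_int (binom2 m) :: 'a::field_char_0) = of_int m gchoose 2"
proof -
  have "(of_int (2 * binom2 m) :: 'a) = of_int (m * (m - 1))"
    by (simp only: two_times_binom2)
  then have "(2 * of_int (binom2 m) :: 'a) = of_int m * (of_int m - 1)" by simp
  then show ?thesis by (simp add: gbinomial_prod_rev numeral_2_eq_2 field_simps)
qed

end

theory Submission
  imports Defs
begin

text \<open>
  Set \<open>y = 0\<close> and slice the polymatroid of \<open>f\<close> on \<open>{1..n + 1}\<close> by the value \<open>t\<close> of the last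
  coordinate. The slices are polymatroids on \<open>{1..n}\<close>, and activity of an element below \<open>n + 1\<close> only
  depends on its slice. Let \<open>l = f {1..n + 1} - f {1..n}\<close> and \<open>u = f {n + 1}\<close> be the extreme values
  of \<open>t\<close>. As unions of tight sets are tight, \<open>n + 1\<close> is internally active iff \<open>t = l\<close>, and dually
  externally active iff \<open>t = u\<close>. Hence, with \<open>X\<close> denoting the Tutte polynomial at \<open>y = 0\<close>,
  \<open>X = x * X\<^sub>l + (\<Sum>l < t < u. X\<^sub>t)\<close>, where the sum means \<open>- X\<^sub>l\<close> if \<open>l = u\<close>. Comparing the
  coefficients of \<open>x\<^sup>n\<close>, \<open>x\<^sup>n\<^sup>-\<^sup>1\<close>, \<open>x\<^sup>n\<^sup>-\<^sup>2\<close> inductively gives the first formula; each pair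
  \<open>{i, n + 1}\<close> contributes through the rank \<open>min (f {i}) (f {i, n + 1} - t)\<close> of \<open>{i}\<close> in a slice.
  The second formula is the first one for the polymatroid \<open>- P\<close>.
\<close>

section \<open>Dual rank, tight sets, slices and weights\<close>

text \<open>The rank function of the negated polymatroid: as the total is fixed, the sum of
  \<open>- a\<close> over \<open>I\<close> is the sum of \<open>a\<close> over the complement minus
  \<open>f {1..n}\<close>.\<close>

definition dual_rank :: "nat \<Rightarrow> (nat set \<Rightarrow> int) \<Rightarrow> nat set \<Rightarrow> int" where
  "dual_rank n f I = f ({1..n} - I) - f {1..n}"

definition tight :: "nat \<Rightarrow> (nat set \<Rightarrow> int) \<Rightarrow> (nat \<Rightarrow> int) \<Rightarrow> nat set \<Rightarrow> bool" where
  "tight n f a I \<longleftrightarrow> I \<subseteq> {1..n} \<and> sum a I = f I"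

text \<open>Once the last coordinate is fixed to \<open>t\<close>, a set \<open>I\<close> is bounded
  twice, through \<open>I\<close> itself and through \<open>insert (Suc n) I\<close>; the stronger
  bound counts.\<close>

definition slice_rank :: "nat \<Rightarrow> (nat set \<Rightarrow> int) \<Rightarrow> int \<Rightarrow> nat set \<Rightarrow> int" where
  "slice_rank n f t I = min (f I) (f (insert (Suc n) I) - t)"

text \<open>
  The summand of the Tutte polynomial at \<open>y = 0\<close>: the factor \<open>0 ^ card (B - A)\<close> becomes the
  condition \<open>B \<subseteq> A\<close>.
\<close>

definition active_weight :: "nat set \<Rightarrow> nat set \<Rightarrow> int poly" where
  "active_weight A B =
     (if B \<subseteq> A then [:0, 1:] ^ card (A - B) * [:-1, 1:] ^ card (A \<inter> B) else 0)"

definition x_part :: "nat \<Rightarrow> (nat set \<Rightarrow> int) \<Rightarrow> int poly" where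
  "x_part n f = (\<Sum>a\<in>polymatroid n f.
     active_weight (int_active n (polymatroid n f) a) (ext_active n (polymatroid n f) a))"

lemma submodularD:
  assumes "rank_function n f" "I \<subseteq> {1..n}" "J \<subseteq> {1..n}"
  shows "f (I \<union> J) + f (I \<inter> J) \<le> f I + f J"
  using assms unfolding rank_function_def submodular_def by blast

lemma polymatroid_leD: "a \<in> polymatroid n f \<Longrightarrow> I \<subseteq> {1..n} \<Longrightarrow> sum a I \<le> f I"
  unfolding polymatroid_def by blast

section \<open>Duality under negation\<close>

lemma rank_function_dual:
  assumes f: "rank_function n f"
  shows "rank_function n (dual_rank n f)"
  unfolding rank_function_def submodular_def dual_rank_def
proof (intro conjI allI impI)
  fix I J assume "I \<subseteq> {1..n}" "J \<subseteq> {1..n}"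
  have "{1..n} - (I \<union> J) = ({1..n} - I) \<inter> ({1..n} - J)"
       "{1..n} - (I \<inter> J) = ({1..n} - I) \<union> ({1..n} - J)" by auto
  then show "f ({1..n} - (I \<union> J)) - f {1..n} + (f ({1..n} - (I \<inter> J)) - f {1..n})
      \<le> f ({1..n} - I) - f {1..n} + (f ({1..n} - J) - f {1..n})"
    using submodularD[OF f, of "{1..n} - I" "{1..n} - J"] by auto
qed simp

text \<open>Given the total, the dual bound on the complement of \<open>I\<close> is the original
  bound on \<open>I\<close>, and complementation permutes the subsets of
  \<open>{1..n}\<close>.\<close>

lemma uminus_mem_polymatroid_dual:
  assumes f: "rank_function n f"
  shows "- a \<in> polymatroid n (dual_rank n f) \<longleftrightarrow> a \<in> polymatroid n f"
proof -
  have f0: "f {} = 0" using f by (simp add: rank_function_def)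
  have v: "- a \<in> int_vectors n \<longleftrightarrow> a \<in> int_vectors n"
    by (simp add: int_vectors_def)
  have tot: "sum (- a) {1..n} = dual_rank n f {1..n} \<longleftrightarrow> sum a {1..n} = f {1..n}"
    by (simp add: dual_rank_def f0 sum_negf)
  have le: "sum (- a) ({1..n} - I) \<le> dual_rank n f ({1..n} - I) \<longleftrightarrow> sum a I \<le> f I"
    if "sum a {1..n} = f {1..n}" "I \<subseteq> {1..n}" for I
  proof -
    have "sum a ({1..n} - I) = sum a {1..n} - sum a I"
      using that(2) by (intro sum_diff) auto
    then show ?thesis
      using that by (simp add: dual_rank_def sum_negf double_diff)
  qed
  have "(\<forall>I. I \<subseteq> {1..n} \<longrightarrow> sum (- a) I \<le> dual_rank n f I) \<longleftrightarrow>
      (\<forall>I. I \<subseteq> {1..n} \<longrightarrow> sum a I \<le> f I)" if t: "sum a {1..n} = f {1..n}"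
  proof (intro iffI allI impI)
    fix I assume "\<forall>I. I \<subseteq> {1..n} \<longrightarrow> sum (- a) I \<le> dual_rank n f I" "I \<subseteq> {1..n}"
    then show "sum a I \<le> f I" using le[OF t, of I] by (metis Diff_subset)
  next
    fix I assume *: "\<forall>I. I \<subseteq> {1..n} \<longrightarrow> sum a I \<le> f I" "I \<subseteq> {1..n}"
    then have "sum a ({1..n} - I) \<le> f ({1..n} - I)" by blast
    then show "sum (- a) I \<le> dual_rank n f I"
      using le[OF t, of "{1..n} - I"] *(2) by (simp add: double_diff)
  qed
  then show ?thesis unfolding polymatroid_def mem_Collect_eq using v tot by blast
qed

lemma int_active_dual:
  assumes f: "rank_function n f"
  shows "int_active n (polymatroid n (dual_rank n f)) (- a) = ext_active n (polymatroid n f) a"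
proof -
  have "- a - unit_vec i + unit_vec j = - (a + unit_vec i - unit_vec j)" for i j :: nat by simp
  then show ?thesis
    unfolding int_active_def ext_active_def
    by (metis (lifting) uminus_mem_polymatroid_dual[OF f])
qed

lemma ext_active_dual:
  assumes f: "rank_function n f"
  shows "ext_active n (polymatroid n (dual_rank n f)) (- a) = int_active n (polymatroid n f) a"
proof -
  have "- a + unit_vec i - unit_vec j = - (a - unit_vec i + unit_vec j)" for i j :: nat by simp
  then show ?thesis
    unfolding int_active_def ext_active_def
    by (metis (lifting) uminus_mem_polymatroid_dual[OF f])
qed

text \<open>Negation is a bijection between the two polymatroids that exchanges internal and
  external activity. This reduces the case \<open>x = 0\<close> to the case
  \<open>y = 0\<close>.\<close>

lemma x_part_dual:
  assumes f: "rank_function n f"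
  shows "x_part n (dual_rank n f) = (\<Sum>a\<in>polymatroid n f.
     active_weight (ext_active n (polymatroid n f) a) (int_active n (polymatroid n f) a))"
  unfolding x_part_def
  by (rule sum.reindex_bij_witness[of _ uminus uminus])
     (use uminus_mem_polymatroid_dual[OF f] int_active_dual[OF f] ext_active_dual[OF f] in
       \<open>auto, metis minus_minus, metis minus_minus\<close>)

section \<open>Tight sets and activity of the last element\<close>

text \<open>Sums of \<open>a\<close> are modular and \<open>f\<close> is submodular, so equality at
  \<open>I\<close> and \<open>J\<close> leaves no slack at the union and the intersection.\<close>

lemma tight_Un:
  assumes f: "rank_function n f" and a: "a \<in> polymatroid n f"
    and I: "tight n f a I" and J: "tight n f a J"
  shows "tight n f a (I \<union> J)"
proof -
  have s: "I \<subseteq> {1..n}" "J \<subseteq> {1..n}" "sum a I = f I" "sum a J = f J"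
    using I J by (auto simp: tight_def)
  have "finite I" "finite J" using s finite_subset by blast+
  then have "sum a (I \<union> J) + sum a (I \<inter> J) = f I + f J"
    using s by (simp add: sum.union_inter)
  moreover have "sum a (I \<inter> J) \<le> f (I \<inter> J)" "sum a (I \<union> J) \<le> f (I \<union> J)"
    using polymatroid_leD[OF a] s by (auto simp: le_infI1)
  ultimately show ?thesis
    using submodularD[OF f s(1,2)] s by (auto simp: tight_def)
qed

lemma tight_UNION:
  assumes f: "rank_function n f" and a: "a \<in> polymatroid n f" and "finite K"
    and "\<And>j. j \<in> K \<Longrightarrow> tight n f a (T j)"
  shows "tight n f a (\<Union>j\<in>K. T j)"
  using assms(3,4)
proof (induction K rule: finite_induct)
  case empty
  then show ?case using f by (simp add: tight_def rank_function_def)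
next
  case (insert j K)
  then show ?case using tight_Un[OF f a, of "T j" "\<Union>j\<in>K. T j"] by simp
qed

text \<open>The exchange increases the sum, by one, only over sets containing \<open>j\<close> but
  not \<open>i\<close>. By integrality such a set can become violated only if its bound was
  attained.\<close>

lemma exchange_blocked_tight:
  assumes a: "a \<in> polymatroid n f" and i: "i \<in> {1..n}" and j: "j \<in> {1..n}" and "i \<noteq> j"
    and not: "a - unit_vec i + unit_vec j \<notin> polymatroid n f"
  obtains I where "tight n f a I" "j \<in> I" "i \<notin> I"
proof -
  let ?b = "a - unit_vec i + unit_vec j"
  have s: "sum ?b I = sum a I - (if i \<in> I then 1 else 0) + (if j \<in> I then 1 else 0)"
    if "I \<subseteq> {1..n}" for I
    using finite_subset[OF that]
    by (simp add: sum.distrib sum_subtractf unit_vec_def)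
  have "?b \<in> int_vectors n"
    using a i j by (auto simp: polymatroid_def int_vectors_def unit_vec_def)
  moreover have "sum ?b {1..n} = f {1..n}"
    using s[of "{1..n}"] a i j by (simp add: polymatroid_def)
  ultimately obtain I where I: "I \<subseteq> {1..n}" "\<not> sum ?b I \<le> f I"
    using not unfolding polymatroid_def by blast
  have "sum a I \<le> f I" using polymatroid_leD[OF a I(1)] .
  then have "tight n f a I" "j \<in> I" "i \<notin> I"
    using I s[OF I(1)] by (auto simp: tight_def split: if_splits)
  then show ?thesis by (rule that)
qed

text \<open>All other elements are smaller than \<open>Suc n\<close>, so activity yields for each
  \<open>j\<close> a tight set that contains \<open>j\<close> and avoids \<open>Suc n\<close>. Their
  union \<open>{1..n}\<close> is tight, which makes the last coordinate minimal. Conversely, a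
  minimal coordinate cannot be lowered.\<close>

lemma last_int_active_iff:
  assumes f: "rank_function (Suc n) f" and a: "a \<in> polymatroid (Suc n) f"
  shows "Suc n \<in> int_active (Suc n) (polymatroid (Suc n) f) a \<longleftrightarrow>
    a (Suc n) = f {1..Suc n} - f {1..n}"
proof -
  let ?P = "polymatroid (Suc n) f"
  have tot: "sum b {1..n} + b (Suc n) = f {1..Suc n}" if "b \<in> ?P" for b
    using that by (simp add: polymatroid_def)
  have le: "sum b {1..n} \<le> f {1..n}" if "b \<in> ?P" for b
    using polymatroid_leD[OF that, of "{1..n}"] by simp
  show ?thesis
  proof
    assume act: "Suc n \<in> int_active (Suc n) ?P a"
    have "\<exists>I. tight (Suc n) f a I \<and> j \<in> I \<and> Suc n \<notin> I" if "j \<in> {1..n}" for j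
      using act that exchange_blocked_tight[OF a, of "Suc n" j] by (auto simp: int_active_def)
    then obtain T where T: "\<And>j. j \<in> {1..n} \<Longrightarrow> tight (Suc n) f a (T j) \<and> j \<in> T j \<and> Suc n \<notin> T j"
      by metis
    have "(\<Union>j\<in>{1..n}. T j) = {1..n}"
      using T by (fastforce simp: tight_def atLeastAtMostSuc_conv)
    then have "sum a {1..n} = f {1..n}"
      using tight_UNION[OF f a, of "{1..n}" T] T by (simp add: tight_def)
    then show "a (Suc n) = f {1..Suc n} - f {1..n}" using tot[OF a] by simp
  next
    assume min: "a (Suc n) = f {1..Suc n} - f {1..n}"
    have "a - unit_vec (Suc n) + unit_vec j \<notin> ?P" if "j < Suc n" for j
    proof
      assume "a - unit_vec (Suc n) + unit_vec j \<in> ?P"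
      from tot[OF this] le[OF this] show False
        using min that by (simp add: unit_vec_def)
    qed
    then show "Suc n \<in> int_active (Suc n) ?P a" by (simp add: int_active_def)
  qed
qed

lemma last_ext_active_iff:
  assumes f: "rank_function (Suc n) f" and a: "a \<in> polymatroid (Suc n) f"
  shows "Suc n \<in> ext_active (Suc n) (polymatroid (Suc n) f) a \<longleftrightarrow> a (Suc n) = f {Suc n}"
proof -
  have "- a \<in> polymatroid (Suc n) (dual_rank (Suc n) f)"
    using a uminus_mem_polymatroid_dual[OF f] by blast
  note * = last_int_active_iff[OF rank_function_dual[OF f] this, unfolded int_active_dual[OF f]]
  have "{1..Suc n} - {1..n} = {Suc n}" by auto
  then show ?thesis
    using * f by (auto simp: dual_rank_def rank_function_def)
qed

section \<open>Slices by the last coordinate\<close>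

text \<open>Each of the four ways to attain the two minima on the right is covered by submodularity
  of \<open>f\<close> for the sets with or without \<open>Suc n\<close>. The bound on
  \<open>t\<close> gives the value \<open>0\<close> at the empty set.\<close>

lemma rank_function_slice:
  assumes f: "rank_function (Suc n) f" and t: "t \<le> f {Suc n}"
  shows "rank_function n (slice_rank n f t)"
  unfolding rank_function_def submodular_def
proof (intro conjI allI impI)
  show "slice_rank n f t {} = 0" using f t by (simp add: slice_rank_def rank_function_def)
  fix I J assume "I \<subseteq> {1..n}" "J \<subseteq> {1..n}"
  then have s: "I \<subseteq> {1..Suc n}" "J \<subseteq> {1..Suc n}"
      "insert (Suc n) I \<subseteq> {1..Suc n}" "insert (Suc n) J \<subseteq> {1..Suc n}"
    and "Suc n \<notin> I" "Suc n \<notin> J" by auto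
  then have "insert (Suc n) I \<inter> J = I \<inter> J" "I \<inter> insert (Suc n) J = I \<inter> J" by auto
  then show "slice_rank n f t (I \<union> J) + slice_rank n f t (I \<inter> J)
      \<le> slice_rank n f t I + slice_rank n f t J"
    using submodularD[OF f s(1,2)] submodularD[OF f s(1,4)] submodularD[OF f s(3,2)]
      submodularD[OF f s(3,4)]
    unfolding slice_rank_def by (simp add: min_def)
qed

lemma last_coordinate_bounds:
  assumes "a \<in> polymatroid (Suc n) f"
  shows "f {1..Suc n} - f {1..n} \<le> a (Suc n)" "a (Suc n) \<le> f {Suc n}"
proof -
  show "f {1..Suc n} - f {1..n} \<le> a (Suc n)"
  proof -
    have "sum a {1..n} + a (Suc n) = f {1..Suc n}" using assms by (simp add: polymatroid_def)
    then show ?thesis using polymatroid_leD[OF assms, of "{1..n}"] by simp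
  qed
  show "a (Suc n) \<le> f {Suc n}"
    using polymatroid_leD[OF assms, of "{Suc n}"] by simp
qed

text \<open>The subsets of \<open>{1..Suc n}\<close> pair up as \<open>I\<close> and
  \<open>insert (Suc n) I\<close>, and the minimum merges both bounds. The lower bound on
  \<open>t\<close> makes the slice rank of \<open>{1..n}\<close> equal to
  \<open>f {1..Suc n} - t\<close>, so that the totals agree.\<close>

lemma mem_polymatroid_slice_iff:
  assumes t: "f {1..Suc n} - f {1..n} \<le> t"
  shows "a(Suc n := 0) \<in> polymatroid n (slice_rank n f t) \<longleftrightarrow>
    a(Suc n := t) \<in> polymatroid (Suc n) f"
proof -
  have v: "a(Suc n := 0) \<in> int_vectors n \<longleftrightarrow> a(Suc n := t) \<in> int_vectors (Suc n)"
    by (auto simp: int_vectors_def)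
  have s: "sum (a(Suc n := u)) I = sum a I" "sum (a(Suc n := u)) (insert (Suc n) I) = sum a I + u"
    if "I \<subseteq> {1..n}" for I u
  proof -
    have "finite I" "Suc n \<notin> I" using that finite_subset by auto
    then show "sum (a(Suc n := u)) I = sum a I" by (intro sum.cong) auto
    with \<open>finite I\<close> \<open>Suc n \<notin> I\<close>
    show "sum (a(Suc n := u)) (insert (Suc n) I) = sum a I + u" by simp
  qed
  have N: "{1..Suc n} = insert (Suc n) {1..n}" by auto
  have tot: "sum (a(Suc n := 0)) {1..n} = slice_rank n f t {1..n} \<longleftrightarrow>
      sum (a(Suc n := t)) {1..Suc n} = f {1..Suc n}"
    using t unfolding N s[OF order_refl] slice_rank_def by auto
  have sub: "(\<forall>I. I \<subseteq> insert (Suc n) {1..n} \<longrightarrow> Q I) \<longleftrightarrow>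
      (\<forall>I. I \<subseteq> {1..n} \<longrightarrow> Q I \<and> Q (insert (Suc n) I))" for Q
    by (metis subset_insert_iff insert_Diff insert_mono subset_insertI2)
  have "(\<forall>I. I \<subseteq> {1..n} \<longrightarrow> sum (a(Suc n := 0)) I \<le> slice_rank n f t I) \<longleftrightarrow>
      (\<forall>I. I \<subseteq> {1..Suc n} \<longrightarrow> sum (a(Suc n := t)) I \<le> f I)"
    unfolding N sub slice_rank_def by (simp add: s le_diff_eq del: fun_upd_apply One_nat_def)
  then show ?thesis unfolding polymatroid_def mem_Collect_eq using v tot by blast
qed

text \<open>Activity of \<open>i\<close> only tests exchanges with \<open>j < i\<close>; these leave
  the last coordinate alone and stay in the slice.\<close>

lemma int_active_slice:
  assumes t: "f {1..Suc n} - f {1..n} \<le> t" and at: "a (Suc n) = t" and i: "i \<in> {1..n}"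
  shows "i \<in> int_active n (polymatroid n (slice_rank n f t)) (a(Suc n := 0)) \<longleftrightarrow>
    i \<in> int_active (Suc n) (polymatroid (Suc n) f) a"
proof -
  have "a(Suc n := 0) - unit_vec i + unit_vec j \<in> polymatroid n (slice_rank n f t) \<longleftrightarrow>
      a - unit_vec i + unit_vec j \<in> polymatroid (Suc n) f" if "j < i" for j
  proof -
    have "(a - unit_vec i + unit_vec j)(Suc n := 0) = a(Suc n := 0) - unit_vec i + unit_vec j"
         "(a - unit_vec i + unit_vec j)(Suc n := t) = a - unit_vec i + unit_vec j"
      using i that at by (auto simp: unit_vec_def fun_eq_iff)
    then show ?thesis using mem_polymatroid_slice_iff[OF t, of "a - unit_vec i + unit_vec j"] by simp
  qed
  then show ?thesis using i by (auto simp: int_active_def)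
qed

lemma ext_active_slice:
  assumes t: "f {1..Suc n} - f {1..n} \<le> t" and at: "a (Suc n) = t" and i: "i \<in> {1..n}"
  shows "i \<in> ext_active n (polymatroid n (slice_rank n f t)) (a(Suc n := 0)) \<longleftrightarrow>
    i \<in> ext_active (Suc n) (polymatroid (Suc n) f) a"
proof -
  have "a(Suc n := 0) + unit_vec i - unit_vec j \<in> polymatroid n (slice_rank n f t) \<longleftrightarrow>
      a + unit_vec i - unit_vec j \<in> polymatroid (Suc n) f" if "j < i" for j
  proof -
    have "(a + unit_vec i - unit_vec j)(Suc n := 0) = a(Suc n := 0) + unit_vec i - unit_vec j"
         "(a + unit_vec i - unit_vec j)(Suc n := t) = a + unit_vec i - unit_vec j"
      using i that at by (auto simp: unit_vec_def fun_eq_iff)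
    then show ?thesis using mem_polymatroid_slice_iff[OF t, of "a + unit_vec i - unit_vec j"] by simp
  qed
  then show ?thesis using i by (auto simp: ext_active_def)
qed

section \<open>Recursion for the Tutte polynomial at \<open>y = 0\<close>\<close>

lemma int_active_subset: "int_active n P a \<subseteq> {1..n}"
  by (auto simp: int_active_def)

lemma ext_active_subset: "ext_active n P a \<subseteq> {1..n}"
  by (auto simp: ext_active_def)

lemma active_weight_insert_left:
  assumes "finite A" "z \<notin> A" "z \<notin> B"
  shows "active_weight (insert z A) B = [:0, 1:] * active_weight A B"
  using assms by (simp add: active_weight_def insert_Diff_if Int_insert_left subset_insert)

lemma active_weight_insert_right:
  assumes "z \<notin> A"
  shows "active_weight A (insert z B) = 0"
  using assms by (simp add: active_weight_def)

lemma active_weight_insert_both: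
  assumes "finite A" "z \<notin> A" "z \<notin> B"
  shows "active_weight (insert z A) (insert z B) = [:-1, 1:] * active_weight A B"
proof -
  have "insert z A - insert z B = A - B" "insert z A \<inter> insert z B = insert z (A \<inter> B)"
    "insert z B \<subseteq> insert z A \<longleftrightarrow> B \<subseteq> A"
    using assms by auto
  moreover have "card (insert z (A \<inter> B)) = Suc (card (A \<inter> B))" using assms by simp
  ultimately show ?thesis unfolding active_weight_def 
    by (simp only: power_Suc mult.left_commute mult_zero_right split: if_split) simp
qed

text \<open>The contribution of \<open>Suc n\<close> to the weight: \<open>x - 1\<close> if active
  in both senses, \<open>x\<close> if only internally, \<open>0\<close> (that is, \<open>y\<close>)
  if only externally, and \<open>1\<close> otherwise.\<close>

definition last_factor :: "int \<Rightarrow> int \<Rightarrow> int \<Rightarrow> int poly" where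
  "last_factor l u t =
     (if t = l \<and> t = u then [:-1, 1:] else if t = l then [:0, 1:] else if t = u then 0 else 1)"

lemma active_weight_slice:
  assumes f: "rank_function (Suc n) f" and a: "a \<in> polymatroid (Suc n) f"
  shows "active_weight (int_active (Suc n) (polymatroid (Suc n) f) a)
      (ext_active (Suc n) (polymatroid (Suc n) f) a) =
    last_factor (f {1..Suc n} - f {1..n}) (f {Suc n}) (a (Suc n)) *
    active_weight (int_active n (polymatroid n (slice_rank n f (a (Suc n)))) (a(Suc n := 0)))
      (ext_active n (polymatroid n (slice_rank n f (a (Suc n)))) (a(Suc n := 0)))"
proof -
  let ?t = "a (Suc n)"
  let ?A = "int_active (Suc n) (polymatroid (Suc n) f) a"
    and ?B = "ext_active (Suc n) (polymatroid (Suc n) f) a"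
  let ?A' = "int_active n (polymatroid n (slice_rank n f ?t)) (a(Suc n := 0))"
    and ?B' = "ext_active n (polymatroid n (slice_rank n f ?t)) (a(Suc n := 0))"
  have t: "f {1..Suc n} - f {1..n} \<le> ?t" using last_coordinate_bounds[OF a] by blast
  have "finite ?A'" by (rule finite_subset[OF int_active_subset]) simp
  moreover have "Suc n \<notin> ?A'" "Suc n \<notin> ?B'"
    by (simp_all add: int_active_def ext_active_def)
  moreover have "?A = (if ?t = f {1..Suc n} - f {1..n} then insert (Suc n) ?A' else ?A')"
  proof (rule set_eqI)
    fix i
    show "i \<in> ?A \<longleftrightarrow> i \<in> (if ?t = f {1..Suc n} - f {1..n} then insert (Suc n) ?A' else ?A')"
    proof (cases "i \<in> {1..n}")
      case True
      then show ?thesis using int_active_slice[of f n ?t a i, OF t refl True] by auto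
    next
      case False
      then have "i \<notin> ?A'" "i \<noteq> Suc n \<Longrightarrow> i \<notin> ?A" by (auto simp: int_active_def)
      then show ?thesis using last_int_active_iff[OF f a] by auto
    qed
  qed
  moreover have "?B = (if ?t = f {Suc n} then insert (Suc n) ?B' else ?B')"
  proof (rule set_eqI)
    fix i
    show "i \<in> ?B \<longleftrightarrow> i \<in> (if ?t = f {Suc n} then insert (Suc n) ?B' else ?B')"
    proof (cases "i \<in> {1..n}")
      case True
      then show ?thesis using ext_active_slice[of f n ?t a i, OF t refl True] by auto
    next
      case False
      then have "i \<notin> ?B'" "i \<noteq> Suc n \<Longrightarrow> i \<notin> ?B" by (auto simp: ext_active_def)
      then show ?thesis using last_ext_active_iff[OF f a] by auto
    qed
  qed
  ultimately show ?thesis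
    using active_weight_insert_left[of ?A' "Suc n" ?B'] active_weight_insert_right[of "Suc n" ?A' ?B']
      active_weight_insert_both[of ?A' "Suc n" ?B']
    unfolding last_factor_def by (auto simp only: split: if_splits)
qed

lemma x_part_slices:
  assumes f: "rank_function (Suc n) f"
  shows "x_part (Suc n) f = (\<Sum>t\<in>{f {1..Suc n} - f {1..n}..f {Suc n}}.
    last_factor (f {1..Suc n} - f {1..n}) (f {Suc n}) t * x_part n (slice_rank n f t))"
proof -
  let ?l = "f {1..Suc n} - f {1..n}" and ?u = "f {Suc n}"
  let ?P = "polymatroid (Suc n) f"
  define W where "W t b = last_factor ?l ?u t *
    active_weight (int_active n (polymatroid n (slice_rank n f t)) b)
      (ext_active n (polymatroid n (slice_rank n f t)) b)" for t b
  have z: "b (Suc n) = 0" if "b \<in> polymatroid n g" for b g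
    using that by (auto simp: polymatroid_def int_vectors_def)
  have "x_part (Suc n) f = (\<Sum>a\<in>?P. W (a (Suc n)) (a(Suc n := 0)))"
    unfolding x_part_def W_def using active_weight_slice[OF f] by (intro sum.cong refl)
  \<comment> \<open>A vector corresponds to its last coordinate \<open>t\<close> together with the
    vector in which that coordinate is reset to \<open>0\<close>.\<close>
  also have "\<dots> = (\<Sum>(t, b)\<in>(SIGMA t:{?l..?u}. polymatroid n (slice_rank n f t)). W t b)"
  proof (rule sum.reindex_bij_witness[of _ "\<lambda>(t, b). b(Suc n := t)"
        "\<lambda>a. (a (Suc n), a(Suc n := 0))"], goal_cases)
    case (2 a)
    then show ?case
      using last_coordinate_bounds[OF 2] mem_polymatroid_slice_iff[of f n "a (Suc n)" a] by auto
  next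
    case (4 p)
    then obtain t b where p: "p = (t, b)" "?l \<le> t" "b \<in> polymatroid n (slice_rank n f t)" by auto
    then have "b(Suc n := 0) = b" using z by (simp add: fun_upd_idem)
    then show ?case using p mem_polymatroid_slice_iff[of f n t b] by simp
  next
    case (3 p)
    then show ?case using z by (auto simp: fun_upd_idem)
  qed auto
  also have "\<dots> = (\<Sum>t\<in>{?l..?u}. \<Sum>b\<in>polymatroid n (slice_rank n f t). W t b)"
    by (rule sum.Sigma[symmetric]) (simp_all add: finite_polymatroid)
  finally show ?thesis by (simp add: W_def x_part_def sum_distrib_left)
qed

lemma polymatroid_cong:
  assumes "\<And>I. I \<subseteq> {1..n} \<Longrightarrow> f I = g I"
  shows "polymatroid n f = polymatroid n g"
  using assms by (auto simp: polymatroid_def)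

lemma submodular_last:
  assumes f: "rank_function (Suc n) f" and I: "I \<subseteq> J" "J \<subseteq> {1..n}"
  shows "f (insert (Suc n) J) - f J \<le> f (insert (Suc n) I) - f I"
proof -
  have "insert (Suc n) I \<union> J = insert (Suc n) J" "insert (Suc n) I \<inter> J = I"
    "insert (Suc n) I \<subseteq> {1..Suc n}" "J \<subseteq> {1..Suc n}"
    using I by auto
  then show ?thesis using submodularD[OF f, of "insert (Suc n) I" J] by simp
qed

text \<open>The marginal value of \<open>Suc n\<close> is smallest over \<open>{1..n}\<close>, so at
  this \<open>t\<close> the minimum in \<open>slice_rank\<close> is always
  \<open>f I\<close>.\<close>

lemma x_part_slice_min:
  assumes f: "rank_function (Suc n) f"
  shows "x_part n (slice_rank n f (f {1..Suc n} - f {1..n})) = x_part n f"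
proof -
  have "insert (Suc n) {1..n} = {1..Suc n}" by auto
  then have "slice_rank n f (f {1..Suc n} - f {1..n}) I = f I" if "I \<subseteq> {1..n}" for I
    using submodular_last[OF f that order_refl] by (simp add: slice_rank_def)
  then have "polymatroid n (slice_rank n f (f {1..Suc n} - f {1..n})) = polymatroid n f"
    by (rule polymatroid_cong)
  then show ?thesis by (simp add: x_part_def)
qed

text \<open>If the end slices differ, the upper one has factor \<open>0\<close>. If they coincide,
  the factor \<open>x - 1\<close> is split so that the term with \<open>x\<close> is common to both
  cases.\<close>

lemma x_part_Suc:
  assumes f: "rank_function (Suc n) f"
  shows "x_part (Suc n) f = [:0, 1:] * x_part n f +
    (if f {1..Suc n} - f {1..n} = f {Suc n} then - x_part n f
     else \<Sum>t\<in>{f {1..Suc n} - f {1..n}<..<f {Suc n}}. x_part n (slice_rank n f t))"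
proof -
  let ?l = "f {1..Suc n} - f {1..n}" and ?u = "f {Suc n}"
  let ?X = "\<lambda>t. x_part n (slice_rank n f t)"
  show ?thesis
  proof (cases "?l = ?u")
    case True
    have "x_part (Suc n) f = [:-1, 1:] * x_part n f"
      unfolding x_part_slices[OF f] x_part_slice_min[OF f, symmetric] using True
      by (simp add: last_factor_def)
    also have "[:-1, 1:] = [:0, 1:] - (1 :: int poly)" by (simp add: one_pCons)
    finally show ?thesis using True by (simp only: left_diff_distrib) simp
  next
    case False
    have "insert (Suc n) {1..n} = {1..Suc n}" by auto
    then have "?l \<le> ?u"
      using submodular_last[OF f, of "{}" "{1..n}"] f by (simp add: rank_function_def)
    then have "{?l..?u} = insert ?l (insert ?u {?l<..<?u})" using False by auto
    then have "x_part (Suc n) f = last_factor ?l ?u ?l * ?X ?l + last_factor ?l ?u ?u * ?X ?u +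
        (\<Sum>t\<in>{?l<..<?u}. last_factor ?l ?u t * ?X t)"
      unfolding x_part_slices[OF f] using False by simp
    moreover have "(\<Sum>t\<in>{?l<..<?u}. last_factor ?l ?u t * ?X t) = (\<Sum>t\<in>{?l<..<?u}. ?X t)"
      by (rule sum.cong) (auto simp: last_factor_def)
    ultimately show ?thesis using False x_part_slice_min[OF f] by (simp add: last_factor_def)
  qed
qed

section \<open>The three highest coefficients\<close>

text \<open>With integer exponents and value \<open>0\<close> below zero, multiplication by
  \<open>x\<close> is a shift for every \<open>k\<close>, without a case distinction for small
  \<open>n\<close>.\<close>

definition int_coeff :: "'a::zero poly \<Rightarrow> int \<Rightarrow> 'a" where
  "int_coeff p k = (if k < 0 then 0 else coeff p (nat k))"

lemma int_coeff_simps: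
  "int_coeff (p + q) k = int_coeff p k + int_coeff q k"
  "int_coeff (- r) k = - int_coeff r k"
  for p q :: "'a::comm_monoid_add poly" and r :: "'b::ab_group_add poly"
  by (simp_all add: int_coeff_def)

lemma int_coeff_sum: "int_coeff (\<Sum>i\<in>A. g i) k = (\<Sum>i\<in>A. int_coeff (g i) k)"
  by (simp add: int_coeff_def coeff_sum)

lemma int_coeff_X_mult: "int_coeff ([:0, 1:] * p) k = int_coeff p (k - 1)"
  for p :: "'a::comm_semiring_1 poly"
proof (cases "k > 0")
  case True
  then have "nat k = Suc (nat (k - 1))" by simp
  then show ?thesis using True by (simp add: int_coeff_def)
qed (simp add: int_coeff_def)

lemma int_coeff_x_part_Suc:
  assumes "rank_function (Suc n) f"
  shows "int_coeff (x_part (Suc n) f) k = int_coeff (x_part n f) (k - 1) +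
    (if f {1..Suc n} - f {1..n} = f {Suc n} then - int_coeff (x_part n f) k
     else \<Sum>t\<in>{f {1..Suc n} - f {1..n}<..<f {Suc n}}. int_coeff (x_part n (slice_rank n f t)) k)"
  unfolding x_part_Suc[OF assms] int_coeff_simps int_coeff_X_mult
  by (simp add: int_coeff_simps int_coeff_sum)

lemma rank_function_Suc: "rank_function (Suc n) f \<Longrightarrow> rank_function n f"
  using subset_trans[of _ "{1..n}" "{1..Suc n}"]
  unfolding rank_function_def submodular_def by auto

lemma x_part_0:
  assumes "rank_function 0 f"
  shows "x_part 0 f = 1"
proof -
  have "polymatroid 0 f = {\<lambda>_. 0}"
    using assms by (auto simp: polymatroid_def int_vectors_def rank_function_def)
  then show ?thesis
    by (simp add: x_part_def int_active_def ext_active_def active_weight_def)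
qed

lemma int_coeff_x_part_above:
  assumes "rank_function n f" "int n < k"
  shows "int_coeff (x_part n f) k = 0"
  using assms
proof (induction n arbitrary: f k)
  case 0
  then show ?case by (simp add: x_part_0 int_coeff_def)
next
  case (Suc n)
  then show ?case
    using rank_function_slice[OF Suc.prems(1)] rank_function_Suc[OF Suc.prems(1)]
    by (simp add: int_coeff_x_part_Suc)
qed

text \<open>The polynomials of \<open>f\<close> on \<open>{1..n}\<close> and of the slices have
  degree at most \<open>n\<close>, so only the term multiplied by \<open>x\<close> reaches exponent
  \<open>Suc n\<close>.\<close>

lemma int_coeff_x_part_top:
  assumes "rank_function n f"
  shows "int_coeff (x_part n f) (int n) = 1"
  using assms
proof (induction n arbitrary: f)
  case 0
  then show ?case by (simp add: x_part_0 int_coeff_def)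
next
  case (Suc n)
  then show ?case
    using rank_function_slice[OF Suc.prems] rank_function_Suc[OF Suc.prems]
    by (simp add: int_coeff_x_part_Suc int_coeff_x_part_above)
qed

lemma last_marginal_le:
  assumes "rank_function (Suc n) f" "I \<subseteq> {1..n}"
  shows "f {1..Suc n} - f {1..n} \<le> f (insert (Suc n) I) - f I"
    and "f (insert (Suc n) I) - f I \<le> f {Suc n}"
proof -
  have "insert (Suc n) {1..n} = {1..Suc n}" by auto
  then show "f {1..Suc n} - f {1..n} \<le> f (insert (Suc n) I) - f I"
    using submodular_last[OF assms order_refl] by simp
  show "f (insert (Suc n) I) - f I \<le> f {Suc n}"
    using submodular_last[OF assms(1), of "{}" I] assms by (simp add: rank_function_def)
qed

lemma int_coeff_x_part_1:
  assumes "rank_function n f"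
  shows "int_coeff (x_part n f) (int n - 1) = (\<Sum>i\<in>{1..n}. f {i}) - f {1..n} - int n"
  using assms
proof (induction n arbitrary: f)
  case 0
  then show ?case by (simp add: int_coeff_def rank_function_def)
next
  case (Suc n)
  let ?l = "f {1..Suc n} - f {1..n}" and ?u = "f {Suc n}"
  have "?l \<le> ?u" using last_marginal_le[OF Suc.prems, of "{}"] by simp
  have "(\<Sum>t\<in>{?l<..<?u}. int_coeff (x_part n (slice_rank n f t)) (int n)) = (\<Sum>t\<in>{?l<..<?u}. 1)"
    by (intro sum.cong refl int_coeff_x_part_top rank_function_slice[OF Suc.prems]) simp
  \<comment> \<open>Each slice strictly between the ends contributes its top coefficient
    \<open>1\<close>; the exceptional value \<open>- 1\<close> for \<open>?l = ?u\<close> fits the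
    same formula.\<close>
  then have L: "(if ?l = ?u then - int_coeff (x_part n f) (int n)
      else \<Sum>t\<in>{?l<..<?u}. int_coeff (x_part n (slice_rank n f t)) (int n)) = ?u - ?l - 1"
    using \<open>?l \<le> ?u\<close> int_coeff_x_part_top[OF rank_function_Suc[OF Suc.prems]] by simp
  have "int (Suc n) - 1 = int n" by simp
  then show ?case
    unfolding int_coeff_x_part_Suc[OF Suc.prems] \<open>int (Suc n) - 1 = int n\<close> L
    using Suc.IH[OF rank_function_Suc[OF Suc.prems]] by simp
qed

section \<open>Binomial sums over integer intervals\<close>

lemma binom2_add: "binom2 (a + b) = binom2 a + binom2 b + a * b"
proof -
  have "2 * binom2 (a + b) = 2 * (binom2 a + binom2 b + a * b)"
    unfolding distrib_left two_times_binom2 by (simp add: algebra_simps)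
  then show ?thesis by simp
qed

lemma binom2_0_1 [simp]: "binom2 0 = 0" "binom2 1 = 0"
  by (simp_all add: binom2_def)

lemma greaterThanLessThan_int_plus1: "l < u \<Longrightarrow> {l<..<u + 1} = insert u {l<..<u}" for l u :: int
  by auto

text \<open>There are \<open>u - l - 1\<close> summands, and \<open>t\<close> telescopes as
  \<open>binom2 (t + 1) - binom2 t\<close>.\<close>

lemma sum_affine_int_interval:
  fixes l u c :: int
  assumes "l < u"
  shows "(\<Sum>t\<in>{l<..<u}. c + t) = (u - l - 1) * c + binom2 u - binom2 (l + 1)"
  using assms
proof (induction u rule: int_gr_induct)
  case base
  have "{l<..<l + 1} = {}" by auto
  then show ?case by simp
next
  case (step u)
  show ?case unfolding greaterThanLessThan_int_plus1[OF step(1)]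
    using step by (simp add: binom2_add algebra_simps)
qed

text \<open>The minimum is \<open>c\<close> minus the excess of \<open>t\<close> over
  \<open>s\<close>. As \<open>l \<le> s\<close>, the positive excesses are exactly
  \<open>1, ..., u - s - 1\<close>. The maximum is needed since \<open>binom2\<close> does not
  vanish at negative arguments.\<close>

lemma sum_min_int_interval:
  fixes l u s c :: int
  assumes "l < u" "l \<le> s"
  shows "(\<Sum>t\<in>{l<..<u}. min c (c + s - t)) = (u - l - 1) * c - binom2 (max 0 (u - s))"
  using assms(1)
proof (induction u rule: int_gr_induct)
  case base
  have "{l<..<l + 1} = {}" by auto
  \<comment> \<open>Both possible arguments are zeros of \<open>binom2\<close>.\<close>
  moreover have "max 0 (l + 1 - s) = 0 \<or> max 0 (l + 1 - s) = 1" using assms(2) by auto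
  ultimately show ?case by auto
next
  case (step u)
  have "binom2 (max 0 (u + 1 - s)) = binom2 (max 0 (u - s)) + max 0 (u - s)"
  proof (cases "s \<le> u")
    case True
    then show ?thesis using binom2_add[of "u - s" 1] by (simp add: algebra_simps)
  next
    case False
    then show ?thesis by simp
  qed
  then show ?case unfolding greaterThanLessThan_int_plus1[OF step(1)]
    using step by (simp add: algebra_simps)
qed

section \<open>The coefficient of \<open>x^(n - 2)\<close>\<close>

lemma sum_pairs_Suc:
  "(\<Sum>(i, j)\<in>{(i, j). i \<in> {1..Suc n} \<and> j \<in> {1..Suc n} \<and> i < j}. g i j) =
   (\<Sum>(i, j)\<in>{(i, j). i \<in> {1..n} \<and> j \<in> {1..n} \<and> i < j}. g i j) + (\<Sum>i\<in>{1..n}. g i (Suc n))"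
  for g :: "nat \<Rightarrow> nat \<Rightarrow> int"
proof -
  let ?S = "{(i, j). i \<in> {1..n} \<and> j \<in> {1..n} \<and> i < j}"
  have "{(i, j). i \<in> {1..Suc n} \<and> j \<in> {1..Suc n} \<and> i < j} = ?S \<union> (\<lambda>i. (i, Suc n)) ` {1..n}"
    by (auto simp: le_Suc_eq)
  moreover have "finite ?S" by (rule finite_subset[of _ "{1..n} \<times> {1..n}"]) auto
  moreover have "?S \<inter> (\<lambda>i. (i, Suc n)) ` {1..n} = {}" by auto
  ultimately show ?thesis
    by (simp add: sum.union_disjoint sum.reindex inj_on_def)
qed

lemma int_coeff_x_part_2:
  assumes "rank_function n f"
  shows "int_coeff (x_part n f) (int n - 2) =
    binom2 ((\<Sum>i\<in>{1..n}. f {i}) - f {1..n} + 1 - int n)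
    - (\<Sum>(i, j)\<in>{(i, j). i \<in> {1..n} \<and> j \<in> {1..n} \<and> i < j}. binom2 (f {i} + f {j} - f {i, j}))"
  using assms
proof (induction n arbitrary: f)
  case 0
  then show ?case by (simp add: int_coeff_def rank_function_def)
next
  case (Suc n)
  note f = Suc.prems
  let ?l = "f {1..Suc n} - f {1..n}" and ?u = "f {Suc n}"
  let ?F = "\<Sum>i\<in>{1..n}. f {i}"
  let ?D = "\<Sum>i\<in>{1..n}. binom2 (f {i} + f {Suc n} - f {i, Suc n})"
  let ?L = "if ?l = ?u then - int_coeff (x_part n f) (int n - 1)
    else \<Sum>t\<in>{?l<..<?u}. int_coeff (x_part n (slice_rank n f t)) (int n - 1)"
  have lu: "?l \<le> ?u" using last_marginal_le[OF f, of "{}"] by simp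
  have b: "?l \<le> f {i, Suc n} - f {i}" "f {i, Suc n} - f {i} \<le> ?u" if "i \<in> {1..n}" for i
    using last_marginal_le[OF f, of "{i}"] that by (simp_all add: insert_commute)
  \<comment> \<open>The right side is the increment of \<open>binom2\<close> from
    \<open>?F - f {1..n} + 1 - int n\<close> when \<open>?u - ?l - 1\<close> is added, minus the
    contribution \<open>?D\<close> of the new pairs.\<close>
  have L: "?L = (?u - ?l - 1) * (?F - f {1..n} + 1 - int n) + binom2 (?u - ?l - 1) - ?D"
  proof (cases "?l = ?u")
    case True
    \<comment> \<open>Here the bounds \<open>b\<close> pin the marginal value of
      \<open>Suc n\<close> over \<open>{i}\<close> to \<open>?u\<close>.\<close>
    have "binom2 (f {i} + f {Suc n} - f {i, Suc n}) = 0" if "i \<in> {1..n}" for i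
    proof -
      have "f {i} + f {Suc n} - f {i, Suc n} = 0" using b[OF that] True by linarith
      then show ?thesis by simp
    qed
    then have "?D = 0" by (simp add: sum.neutral)
    moreover have "binom2 (?u - ?l - 1) = 1" using True by (simp add: binom2_def)
    ultimately show ?thesis
      using True int_coeff_x_part_1[OF rank_function_Suc[OF f]] by simp
  next
    case False
    then have less: "?l < ?u" using lu by simp
    \<comment> \<open>The ranks of singletons in the slice are written in the shape of
      \<open>sum_min_int_interval\<close>, with the marginal value of \<open>Suc n\<close> over
      \<open>{i}\<close> as \<open>s\<close>.\<close>
    have "int_coeff (x_part n (slice_rank n f t)) (int n - 1) =
        (\<Sum>i\<in>{1..n}. min (f {i}) (f {i} + (f {i, Suc n} - f {i}) - t)) + (- f {1..Suc n} - int n + t)"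
      if "t \<in> {?l<..<?u}" for t
    proof -
      have "insert (Suc n) {1..n} = {1..Suc n}" by auto
      then have "slice_rank n f t {1..n} = f {1..Suc n} - t" using that by (simp add: slice_rank_def)
      then show ?thesis
        using int_coeff_x_part_1[OF rank_function_slice[OF f, of t]] that
        by (simp add: slice_rank_def insert_commute)
    qed
    then have "?L = (\<Sum>t\<in>{?l<..<?u}. \<Sum>i\<in>{1..n}. min (f {i}) (f {i} + (f {i, Suc n} - f {i}) - t))
        + (\<Sum>t\<in>{?l<..<?u}. - f {1..Suc n} - int n + t)"
      using False by (simp add: sum.distrib)
    also have "(\<Sum>t\<in>{?l<..<?u}. \<Sum>i\<in>{1..n}. min (f {i}) (f {i} + (f {i, Suc n} - f {i}) - t))
      = (\<Sum>i\<in>{1..n}. \<Sum>t\<in>{?l<..<?u}. min (f {i}) (f {i} + (f {i, Suc n} - f {i}) - t))"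
      by (rule sum.swap)
    also have "\<dots> = (\<Sum>i\<in>{1..n}. (?u - ?l - 1) * f {i} - binom2 (f {i} + f {Suc n} - f {i, Suc n}))"
    proof (rule sum.cong[OF refl])
      fix i assume i: "i \<in> {1..n}"
      \<comment> \<open>Submodularity makes the argument nonnegative, so the maximum
        disappears.\<close>
      have "max 0 (?u - (f {i, Suc n} - f {i})) = f {i} + f {Suc n} - f {i, Suc n}"
        using b[OF i] by simp
      then show "(\<Sum>t\<in>{?l<..<?u}. min (f {i}) (f {i} + (f {i, Suc n} - f {i}) - t))
          = (?u - ?l - 1) * f {i} - binom2 (f {i} + f {Suc n} - f {i, Suc n})"
        using sum_min_int_interval[OF less b(1)[OF i], of "f {i}"] by (simp only:)
    qed
    also have "\<dots> = (?u - ?l - 1) * ?F - ?D"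
      by (simp only: sum_subtractf sum_distrib_left)
    also have "(\<Sum>t\<in>{?l<..<?u}. - f {1..Suc n} - int n + t) =
        (?u - ?l - 1) * (- f {1..Suc n} - int n) + binom2 ?u - binom2 (?l + 1)"
      by (rule sum_affine_int_interval[OF less])
    finally have *: "?L = (?u - ?l - 1) * ?F - ?D
      + ((?u - ?l - 1) * (- f {1..Suc n} - int n) + binom2 ?u - binom2 (?l + 1))" .
    \<comment> \<open>Splitting \<open>?u\<close> at \<open>?l + 1\<close> cancels
      \<open>binom2 (?l + 1)\<close>; the product term turns \<open>- f {1..Suc n}\<close> into
      \<open>- f {1..n} + 1\<close>.\<close>
    have "binom2 ?u = binom2 (?l + 1) + binom2 (?u - ?l - 1) + (?l + 1) * (?u - ?l - 1)"
      using binom2_add[of "?l + 1" "?u - ?l - 1"] by simp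
    then show ?thesis
      unfolding * by (simp add: algebra_simps)
  qed
  let ?A = "?F - f {1..n} + 1 - int n"
  have A: "(\<Sum>i\<in>{1..Suc n}. f {i}) - f {1..Suc n} + 1 - int (Suc n) = ?A + (?u - ?l - 1)" by simp
  have "int (Suc n) - 2 - 1 = int n - 2" "int (Suc n) - 2 = int n - 1" by simp_all
  then have "int_coeff (x_part (Suc n) f) (int (Suc n) - 2) = int_coeff (x_part n f) (int n - 2) + ?L"
    unfolding int_coeff_x_part_Suc[OF f] by simp
  then show ?case
    unfolding L Suc.IH[OF rank_function_Suc[OF f]] A sum_pairs_Suc binom2_add[of ?A]
    by (simp add: algebra_simps)
qed

section \<open>Setting one variable of the Tutte polynomial to zero\<close>

lemma coeff_0_mult: "coeff (p * q) 0 = coeff p 0 * coeff q 0"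
  by (simp add: coeff_mult)

lemma coeff_0_power: "coeff (p ^ k) 0 = coeff p 0 ^ k"
  by (induction k) (simp_all add: coeff_0_mult)

text \<open>The outer variable is \<open>y\<close>, so \<open>y = 0\<close> is a plain
  \<open>coeff _ 0\<close>, whereas \<open>x = 0\<close> has to be applied to every
  coefficient.\<close>

definition subst_x_0 :: "int poly poly \<Rightarrow> int poly" where
  "subst_x_0 = map_poly (\<lambda>p. coeff p 0)"

lemma coeff_subst_x_0: "coeff (subst_x_0 g) k = coeff (coeff g k) 0"
  by (simp add: subst_x_0_def coeff_map_poly)

lemma subst_x_0_sum: "subst_x_0 (sum g A) = (\<Sum>a\<in>A. subst_x_0 (g a))"
  by (rule poly_eqI) (simp add: coeff_subst_x_0 coeff_sum)

lemma subst_x_0_mult: "subst_x_0 (p * q) = subst_x_0 p * subst_x_0 q"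
  by (rule poly_eqI) (simp add: coeff_subst_x_0 coeff_mult coeff_sum)

lemma subst_x_0_power: "subst_x_0 (p ^ k) = subst_x_0 p ^ k"
  by (induction k) (simp_all add: subst_x_0_mult, simp add: subst_x_0_def map_poly_1')

text \<open>Taking the constant coefficient in \<open>y\<close> respects sums and products. The
  power of \<open>y\<close> becomes a power of \<open>0\<close>, which is \<open>1\<close> exactly
  when its exponent is \<open>0\<close>.\<close>

lemma coeff_0_Tutte: "coeff (polymatroid_Tutte n (polymatroid n f)) 0 = x_part n f"
proof -
  have *: "(0 :: int poly) ^ card (B - A) = (if B \<subseteq> A then 1 else 0)" if "B \<subseteq> {1..n}" for A B
    using finite_subset[OF that] by (auto simp: power_0_left card_eq_0_iff)
  show ?thesis
    unfolding polymatroid_Tutte_def x_part_def coeff_sum coeff_0_mult coeff_0_power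
    by (rule sum.cong)
      (simp_all add: active_weight_def var_x_def var_y_def *[OF ext_active_subset] one_pCons)
qed

lemma subst_x_0_Tutte:
  assumes f: "rank_function n f"
  shows "subst_x_0 (polymatroid_Tutte n (polymatroid n f)) = x_part n (dual_rank n f)"
proof -
  have *: "(0 :: int poly) ^ card (B - A) = (if B \<subseteq> A then 1 else 0)" if "B \<subseteq> {1..n}" for A B
    using finite_subset[OF that] by (auto simp: power_0_left card_eq_0_iff)
  have v: "subst_x_0 var_x = 0" "subst_x_0 var_y = [:0, 1:]"
    "subst_x_0 (var_x + var_y - 1) = [:-1, 1:]"
    by (simp_all add: subst_x_0_def var_x_def var_y_def map_poly_pCons one_pCons)
  show ?thesis
    unfolding polymatroid_Tutte_def x_part_dual[OF f] subst_x_0_sum subst_x_0_mult subst_x_0_power v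
    by (rule sum.cong)
      (simp_all add: active_weight_def *[OF int_active_subset] Int_commute)
qed

theorem theorem5p4:
  fixes n :: nat and P :: "(nat \<Rightarrow> int) set" and f :: "nat set \<Rightarrow> int"
  assumes "is_polymatroid_with_rank n P f"
  shows
    "x_coeff (int n - 2) (polymatroid_Tutte n P) =
       binom2 ((\<Sum>i\<in>{1..n}. f {i}) - f {1..n} + 1 - int n)
       - (\<Sum>(i, j)\<in>{(i, j). i \<in> {1..n} \<and> j \<in> {1..n} \<and> i < j}.
            binom2 (f {i} + f {j} - f {i, j}))
     \<and>
     y_coeff (int n - 2) (polymatroid_Tutte n P) =
       binom2 ((\<Sum>i\<in>{1..n}. f ({1..n} - {i})) - (int n - 1) * f {1..n} + 1 - int n)
       - (\<Sum>(i, j)\<in>{(i, j). i \<in> {1..n} \<and> j \<in> {1..n} \<and> i < j}.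
            binom2 (f ({1..n} - {i}) + f ({1..n} - {j}) - f ({1..n} - {i, j}) - f {1..n}))"
proof
  have f: "rank_function n f" and P: "P = polymatroid n f"
    using assms by (auto simp: is_polymatroid_with_rank_def)
  have "x_coeff (int n - 2) (polymatroid_Tutte n P) = int_coeff (x_part n f) (int n - 2)"
    by (simp add: x_coeff_def int_coeff_def P coeff_0_Tutte)
  then show "x_coeff (int n - 2) (polymatroid_Tutte n P) =
       binom2 ((\<Sum>i\<in>{1..n}. f {i}) - f {1..n} + 1 - int n)
       - (\<Sum>(i, j)\<in>{(i, j). i \<in> {1..n} \<and> j \<in> {1..n} \<and> i < j}.
            binom2 (f {i} + f {j} - f {i, j}))"
    by (simp only: int_coeff_x_part_2[OF f])
  \<comment> \<open>The singletons subtract \<open>f {1..n}\<close> altogether \<open>n\<close>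
    times, and \<open>dual_rank n f {1..n} = - f {1..n}\<close> gives one copy back.\<close>
  have sums: "(\<Sum>i\<in>{1..n}. dual_rank n f {i}) - dual_rank n f {1..n} =
      (\<Sum>i\<in>{1..n}. f ({1..n} - {i})) - (int n - 1) * f {1..n}"
    using f by (simp add: dual_rank_def rank_function_def sum_subtractf algebra_simps)
  have pair: "dual_rank n f {i} + dual_rank n f {j} - dual_rank n f {i, j} =
      f ({1..n} - {i}) + f ({1..n} - {j}) - f ({1..n} - {i, j}) - f {1..n}" for i j
    by (simp add: dual_rank_def)
  have "y_coeff (int n - 2) (polymatroid_Tutte n P) =
      int_coeff (x_part n (dual_rank n f)) (int n - 2)"
    by (simp add: y_coeff_def int_coeff_def P coeff_subst_x_0 flip: subst_x_0_Tutte[OF f])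
  then show "y_coeff (int n - 2) (polymatroid_Tutte n P) =
       binom2 ((\<Sum>i\<in>{1..n}. f ({1..n} - {i})) - (int n - 1) * f {1..n} + 1 - int n)
       - (\<Sum>(i, j)\<in>{(i, j). i \<in> {1..n} \<and> j \<in> {1..n} \<and> i < j}.
            binom2 (f ({1..n} - {i}) + f ({1..n} - {j}) - f ({1..n} - {i, j}) - f {1..n}))"
    by (simp only: int_coeff_x_part_2[OF rank_function_dual[OF f]] sums pair)
qed

end
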